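(* Let $(\mathcal{M}, S) \models \mathsf{CS}^-$ and suppose $F$ is an additive idempotent sentential operator. If $$I = \{ c \in M : \forall x \leq c\ \forall \phi \in \mathrm{Sent}^{\mathcal{M}}\ (\mathcal{M},S)\models T(\phi) \equiv T(F(x, \phi)) \},$$ then $I$ is closed under addition.
   Context: $(\mathcal{M},S)\models\mathsf{CS}^-$ means $\mathcal{M}\models\mathsf{PA}$ and $S\subseteq M^2$ is a full compositional satisfaction class for $\mathcal{L}_{\mathsf{PA}}$-formulas in the sense of $\mathcal{M}$ (Tarski clauses for atomic formulas, $\vee$, $\neg$, $\exists$); $T(\phi)$ abbreviates $S(\phi,\emptyset)$. A template is a finite propositional formula $\Phi(p,q)$ (built from connectives and quantifiers over dummy variables) not logically equivalent to $p$, of non-zero complexity, in which $q$ occurs, with $p\wedge q\vdash\Phi(p,q)$ and $\neg p\wedge\neg q\vdash\neg\Phi(p,q)$. The idempotent sentential operator $F$ with template $\Phi$ is defined in $\mathcal{M}$ by $F(0,\phi)=\phi$, $F(x+1,\phi)=\Phi(\phi,F(x,\phi))$ for $\phi\in\mathrm{Sent}^{\mathcal{M}}$. $F$ is additive if $p$ does not occur in $\Phi(p,q)$. *)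

theory Defs
  imports Main
begin

record 'a arith =
  zer :: 'a  ("\<zero>\<index>")
  suc :: "'a \<Rightarrow> 'a"
  add :: "'a \<Rightarrow> 'a \<Rightarrow> 'a"  (infixl "\<oplus>\<index>" 65)
  mul :: "'a \<Rightarrow> 'a \<Rightarrow> 'a"  (infixl "\<otimes>\<index>" 70)

datatype tm = Var nat | Zero | Succ tm | Add tm tm | Mul tm tm

datatype fm = Eq tm tm | Or fm fm | Neg fm | Ex nat fm

primrec tm_val :: "'a arith \<Rightarrow> (nat \<Rightarrow> 'a) \<Rightarrow> tm \<Rightarrow> 'a" where
  "tm_val M e (Var i) = e i"
| "tm_val M e Zero = \<zero>\<^bsub>M\<^esub>"
| "tm_val M e (Succ t) = suc M (tm_val M e t)"
| "tm_val M e (Add s t) = tm_val M e s \<oplus>\<^bsub>M\<^esub> tm_val M e t"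
| "tm_val M e (Mul s t) = tm_val M e s \<otimes>\<^bsub>M\<^esub> tm_val M e t"

primrec sat :: "'a arith \<Rightarrow> (nat \<Rightarrow> 'a) \<Rightarrow> fm \<Rightarrow> bool" where
  "sat M e (Eq s t) \<longleftrightarrow> tm_val M e s = tm_val M e t"
| "sat M e (Or A B) \<longleftrightarrow> sat M e A \<or> sat M e B"
| "sat M e (Neg A) \<longleftrightarrow> \<not> sat M e A"
| "sat M e (Ex i A) \<longleftrightarrow> (\<exists>x. sat M (e(i := x)) A)"

text \<open>The domain of a structure is its whole type. The last conjunct is the truth in \<open>M\<close> of every
  instance of the induction schema, with the parameters supplied by \<open>e\<close>.\<close>

definition PA_model :: "'a arith \<Rightarrow> bool" where
  "PA_model M \<longleftrightarrow>
     (\<forall>x. suc M x \<noteq> \<zero>\<^bsub>M\<^esub>) \<and>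
     (\<forall>x y. suc M x = suc M y \<longrightarrow> x = y) \<and>
     (\<forall>x. x \<oplus>\<^bsub>M\<^esub> \<zero>\<^bsub>M\<^esub> = x) \<and>
     (\<forall>x y. x \<oplus>\<^bsub>M\<^esub> suc M y = suc M (x \<oplus>\<^bsub>M\<^esub> y)) \<and>
     (\<forall>x. x \<otimes>\<^bsub>M\<^esub> \<zero>\<^bsub>M\<^esub> = \<zero>\<^bsub>M\<^esub>) \<and>
     (\<forall>x y. x \<otimes>\<^bsub>M\<^esub> suc M y = x \<otimes>\<^bsub>M\<^esub> y \<oplus>\<^bsub>M\<^esub> x) \<and>
     (\<forall>A i e. sat M (e(i := \<zero>\<^bsub>M\<^esub>)) A \<and>
        (\<forall>x. sat M (e(i := x)) A \<longrightarrow> sat M (e(i := suc M x)) A) \<longrightarrow>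
        (\<forall>x. sat M (e(i := x)) A))"

definition le :: "'a arith \<Rightarrow> 'a \<Rightarrow> 'a \<Rightarrow> bool" where
  "le M x y \<longleftrightarrow> (\<exists>z. x \<oplus>\<^bsub>M\<^esub> z = y)"

definition lt :: "'a arith \<Rightarrow> 'a \<Rightarrow> 'a \<Rightarrow> bool" where
  "lt M x y \<longleftrightarrow> le M (suc M x) y"

primrec num :: "'a arith \<Rightarrow> nat \<Rightarrow> 'a" where
  "num M 0 = \<zero>\<^bsub>M\<^esub>"
| "num M (Suc n) = suc M (num M n)"

text \<open>All notions below are given by first-order conditions over \<open>M\<close>, i.e. they are the
  interpretations in \<open>M\<close> of arithmetical formulas. The pair \<open>\<langle>x,y\<rangle>\<close> is coded by
  \<open>(x + y) * (x + y) + y\<close>, which is injective in PA because \<open>y \<le> x + y\<close>.\<close>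

definition pair :: "'a arith \<Rightarrow> 'a \<Rightarrow> 'a \<Rightarrow> 'a" where
  "pair M x y = (x \<oplus>\<^bsub>M\<^esub> y) \<otimes>\<^bsub>M\<^esub> (x \<oplus>\<^bsub>M\<^esub> y) \<oplus>\<^bsub>M\<^esub> y"

text \<open>Goedel's beta function: \<open>r\<close> is the remainder of \<open>a\<close> modulo \<open>1 + (i + 1) * b\<close>.\<close>

definition beta :: "'a arith \<Rightarrow> 'a \<Rightarrow> 'a \<Rightarrow> 'a \<Rightarrow> 'a \<Rightarrow> bool" where
  "beta M a b i r \<longleftrightarrow>
     lt M r (suc M (suc M i \<otimes>\<^bsub>M\<^esub> b)) \<and> (\<exists>q. a = q \<otimes>\<^bsub>M\<^esub> suc M (suc M i \<otimes>\<^bsub>M\<^esub> b) \<oplus>\<^bsub>M\<^esub> r)"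

text \<open>\<open>y = 2 ^ x\<close> in the sense of \<open>M\<close>.\<close>

definition pow2 :: "'a arith \<Rightarrow> 'a \<Rightarrow> 'a \<Rightarrow> bool" where
  "pow2 M x y \<longleftrightarrow>
     (\<exists>a b. beta M a b \<zero>\<^bsub>M\<^esub> (num M 1) \<and> beta M a b x y \<and>
        (\<forall>i r. lt M i x \<and> beta M a b i r \<longrightarrow> beta M a b (suc M i) (r \<oplus>\<^bsub>M\<^esub> r)))"

text \<open>Ackermann membership: the binary digit of \<open>s\<close> at position \<open>x\<close> is 1. The empty set is coded
  by \<open>\<zero>\<^bsub>M\<^esub>\<close>.\<close>

definition mem :: "'a arith \<Rightarrow> 'a \<Rightarrow> 'a \<Rightarrow> bool" where
  "mem M x s \<longleftrightarrow>
     (\<exists>p q r. pow2 M x p \<and> lt M r p \<and> s = q \<otimes>\<^bsub>M\<^esub> (p \<oplus>\<^bsub>M\<^esub> p) \<oplus>\<^bsub>M\<^esub> p \<oplus>\<^bsub>M\<^esub> r)"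

definition c_var :: "'a arith \<Rightarrow> 'a \<Rightarrow> 'a" where "c_var M i = pair M (num M 1) i"
definition c_zero :: "'a arith \<Rightarrow> 'a" where "c_zero M = pair M (num M 2) \<zero>\<^bsub>M\<^esub>"
definition c_suc :: "'a arith \<Rightarrow> 'a \<Rightarrow> 'a" where "c_suc M t = pair M (num M 3) t"
definition c_add :: "'a arith \<Rightarrow> 'a \<Rightarrow> 'a \<Rightarrow> 'a" where "c_add M s t = pair M (num M 4) (pair M s t)"
definition c_mul :: "'a arith \<Rightarrow> 'a \<Rightarrow> 'a \<Rightarrow> 'a" where "c_mul M s t = pair M (num M 5) (pair M s t)"
definition c_eq :: "'a arith \<Rightarrow> 'a \<Rightarrow> 'a \<Rightarrow> 'a" where "c_eq M s t = pair M (num M 6) (pair M s t)"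
definition c_or :: "'a arith \<Rightarrow> 'a \<Rightarrow> 'a \<Rightarrow> 'a" where "c_or M x y = pair M (num M 7) (pair M x y)"
definition c_neg :: "'a arith \<Rightarrow> 'a \<Rightarrow> 'a" where "c_neg M x = pair M (num M 8) x"
definition c_ex :: "'a arith \<Rightarrow> 'a \<Rightarrow> 'a \<Rightarrow> 'a" where "c_ex M i x = pair M (num M 9) (pair M i x)"

text \<open>Since the tags are nonzero, a code is strictly larger than the codes of its immediate
  constituents. Hence a coded set in which every compound element has its constituents in the set
  is well-founded in the sense of \<open>M\<close>, and such sets serve as formation sequences (likewise as
  evaluation sequences in \<open>value_of\<close>, and as paths through the syntax tree in \<open>is_free\<close>).\<close>

definition is_term :: "'a arith \<Rightarrow> 'a \<Rightarrow> bool" where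
  "is_term M t \<longleftrightarrow>
     (\<exists>w. mem M t w \<and>
        (\<forall>u. mem M u w \<longrightarrow>
           (\<exists>i. u = c_var M i) \<or> u = c_zero M \<or>
           (\<exists>s. mem M s w \<and> u = c_suc M s) \<or>
           (\<exists>s s'. mem M s w \<and> mem M s' w \<and> (u = c_add M s s' \<or> u = c_mul M s s'))))"

definition is_form :: "'a arith \<Rightarrow> 'a \<Rightarrow> bool" where
  "is_form M x \<longleftrightarrow>
     (\<exists>w. mem M x w \<and>
        (\<forall>u. mem M u w \<longrightarrow>
           (\<exists>s t. is_term M s \<and> is_term M t \<and> u = c_eq M s t) \<or>
           (\<exists>y z. mem M y w \<and> mem M z w \<and> u = c_or M y z) \<or>
           (\<exists>y. mem M y w \<and> u = c_neg M y) \<or>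
           (\<exists>i y. mem M y w \<and> u = c_ex M i y)))"

text \<open>\<open>y\<close> is an immediate constituent of \<open>x\<close>, and passing from \<open>x\<close> to \<open>y\<close> does not enter the scope
  of a quantifier binding the variable with index \<open>i\<close>.\<close>

definition free_child :: "'a arith \<Rightarrow> 'a \<Rightarrow> 'a \<Rightarrow> 'a \<Rightarrow> bool" where
  "free_child M i x y \<longleftrightarrow>
     x = c_suc M y \<or> x = c_neg M y \<or>
     (\<exists>z. x = c_add M y z \<or> x = c_add M z y \<or> x = c_mul M y z \<or> x = c_mul M z y \<or>
          x = c_eq M y z \<or> x = c_eq M z y \<or> x = c_or M y z \<or> x = c_or M z y) \<or>
     (\<exists>j. j \<noteq> i \<and> x = c_ex M j y)"

text \<open>The variable with index \<open>i\<close> has a free occurrence in the term or formula \<open>x\<close>.\<close>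

definition is_free :: "'a arith \<Rightarrow> 'a \<Rightarrow> 'a \<Rightarrow> bool" where
  "is_free M i x \<longleftrightarrow>
     (\<exists>w. mem M x w \<and> (\<forall>u. mem M u w \<longrightarrow> u = c_var M i \<or> (\<exists>y. mem M y w \<and> free_child M i u y)))"

definition is_sent :: "'a arith \<Rightarrow> 'a \<Rightarrow> bool" where
  "is_sent M x \<longleftrightarrow> is_form M x \<and> (\<forall>i. \<not> is_free M i x)"

text \<open>An assignment for \<open>x\<close> is a coded function from (the indices of) exactly the free variables
  of \<open>x\<close>; so the empty set is the only assignment for a sentence.\<close>

definition is_asn :: "'a arith \<Rightarrow> 'a \<Rightarrow> 'a \<Rightarrow> bool" where
  "is_asn M x \<alpha> \<longleftrightarrow>
     (\<forall>p. mem M p \<alpha> \<longrightarrow> (\<exists>i a. p = pair M i a \<and> is_free M i x)) \<and>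
     (\<forall>i. is_free M i x \<longrightarrow> (\<exists>!a. mem M (pair M i a) \<alpha>))"

text \<open>\<open>\<gamma>\<close> is the restriction of \<open>\<alpha>\<close> to the free variables of \<open>x\<close>.\<close>

definition is_restr :: "'a arith \<Rightarrow> 'a \<Rightarrow> 'a \<Rightarrow> 'a \<Rightarrow> bool" where
  "is_restr M \<alpha> x \<gamma> \<longleftrightarrow>
     (\<forall>p. mem M p \<gamma> \<longleftrightarrow> mem M p \<alpha> \<and> (\<exists>i a. p = pair M i a \<and> is_free M i x))"

text \<open>\<open>a\<close> is the value of the term \<open>t\<close> under the assignment \<open>\<alpha>\<close>.\<close>

definition value_of :: "'a arith \<Rightarrow> 'a \<Rightarrow> 'a \<Rightarrow> 'a \<Rightarrow> bool" where
  "value_of M \<alpha> t a \<longleftrightarrow>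
     (\<exists>w. mem M (pair M t a) w \<and>
        (\<forall>p. mem M p w \<longrightarrow>
           (\<exists>i b. p = pair M (c_var M i) b \<and> mem M (pair M i b) \<alpha>) \<or>
           p = pair M (c_zero M) \<zero>\<^bsub>M\<^esub> \<or>
           (\<exists>s b. mem M (pair M s b) w \<and> p = pair M (c_suc M s) (suc M b)) \<or>
           (\<exists>s b s' b'. mem M (pair M s b) w \<and> mem M (pair M s' b') w \<and>
              (p = pair M (c_add M s s') (b \<oplus>\<^bsub>M\<^esub> b') \<or> p = pair M (c_mul M s s') (b \<otimes>\<^bsub>M\<^esub> b')))))"

definition CS_minus :: "'a arith \<Rightarrow> ('a \<times> 'a) set \<Rightarrow> bool" where
  "CS_minus M S \<longleftrightarrow>
     PA_model M \<and>
     (\<forall>x \<alpha>. (x, \<alpha>) \<in> S \<longrightarrow> is_form M x \<and> is_asn M x \<alpha>) \<and>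
     (\<forall>s t \<alpha>. is_term M s \<and> is_term M t \<and> is_asn M (c_eq M s t) \<alpha> \<longrightarrow>
        ((c_eq M s t, \<alpha>) \<in> S \<longleftrightarrow> (\<exists>a. value_of M \<alpha> s a \<and> value_of M \<alpha> t a))) \<and>
     (\<forall>x y \<alpha>. is_form M x \<and> is_form M y \<and> is_asn M (c_or M x y) \<alpha> \<longrightarrow>
        ((c_or M x y, \<alpha>) \<in> S \<longleftrightarrow>
           (\<exists>\<gamma>. is_restr M \<alpha> x \<gamma> \<and> (x, \<gamma>) \<in> S) \<or> (\<exists>\<gamma>. is_restr M \<alpha> y \<gamma> \<and> (y, \<gamma>) \<in> S))) \<and>
     (\<forall>x \<alpha>. is_form M x \<and> is_asn M (c_neg M x) \<alpha> \<longrightarrow>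
        ((c_neg M x, \<alpha>) \<in> S \<longleftrightarrow> (x, \<alpha>) \<notin> S)) \<and>
     (\<forall>i x \<alpha>. is_form M x \<and> is_asn M (c_ex M i x) \<alpha> \<longrightarrow>
        ((c_ex M i x, \<alpha>) \<in> S \<longleftrightarrow>
           (\<exists>\<gamma>. is_asn M x \<gamma> \<and>
              (\<forall>j a. j \<noteq> i \<longrightarrow> (mem M (pair M j a) \<gamma> \<longleftrightarrow> mem M (pair M j a) \<alpha>)) \<and> (x, \<gamma>) \<in> S)))"

definition truth :: "'a arith \<Rightarrow> ('a \<times> 'a) set \<Rightarrow> 'a \<Rightarrow> bool" where
  "truth M S x \<longleftrightarrow> (x, \<zero>\<^bsub>M\<^esub>) \<in> S"

text \<open>As in the object language, the primitive logical symbols are disjunction, negation and the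
  existential quantifier; the others are defined from them.\<close>

datatype pvar = P | Q

datatype (atoms: 'v) template =
  TVar 'v
| TOr "'v template" "'v template"
| TNeg "'v template"
| TEx nat "'v template"

definition TAnd :: "'v template \<Rightarrow> 'v template \<Rightarrow> 'v template" where
  "TAnd A B = TNeg (TOr (TNeg A) (TNeg B))"

primrec complexity :: "'v template \<Rightarrow> nat" where
  "complexity (TVar v) = 0"
| "complexity (TOr A B) = Suc (max (complexity A) (complexity B))"
| "complexity (TNeg A) = Suc (complexity A)"
| "complexity (TEx i A) = Suc (complexity A)"

text \<open>The propositional variables stand for sentences, so quantification over a dummy variable is
  vacuous.\<close>

primrec teval :: "('v \<Rightarrow> bool) \<Rightarrow> 'v template \<Rightarrow> bool" where
  "teval b (TVar v) \<longleftrightarrow> b v"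
| "teval b (TOr A B) \<longleftrightarrow> teval b A \<or> teval b B"
| "teval b (TNeg A) \<longleftrightarrow> \<not> teval b A"
| "teval b (TEx i A) \<longleftrightarrow> teval b A"

definition entails :: "'v template \<Rightarrow> 'v template \<Rightarrow> bool" where
  "entails A B \<longleftrightarrow> (\<forall>b. teval b A \<longrightarrow> teval b B)"

definition idempotent_template :: "pvar template \<Rightarrow> bool" where
  "idempotent_template \<Phi> \<longleftrightarrow>
     \<not> (entails \<Phi> (TVar P) \<and> entails (TVar P) \<Phi>) \<and>
     complexity \<Phi> \<noteq> 0 \<and>
     Q \<in> atoms \<Phi> \<and>
     entails (TAnd (TVar P) (TVar Q)) \<Phi> \<and>
     entails (TAnd (TNeg (TVar P)) (TNeg (TVar Q))) (TNeg \<Phi>)"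

text \<open>The code of the sentence obtained from a template by substituting the codes \<open>f v\<close>.\<close>

primrec tinst :: "'a arith \<Rightarrow> ('v \<Rightarrow> 'a) \<Rightarrow> 'v template \<Rightarrow> 'a" where
  "tinst M f (TVar v) = f v"
| "tinst M f (TOr A B) = c_or M (tinst M f A) (tinst M f B)"
| "tinst M f (TNeg A) = c_neg M (tinst M f A)"
| "tinst M f (TEx i A) = c_ex M (num M i) (tinst M f A)"

abbreviation tinst_pq :: "'a arith \<Rightarrow> pvar template \<Rightarrow> 'a \<Rightarrow> 'a \<Rightarrow> 'a" where
  "tinst_pq M \<Phi> x y \<equiv> tinst M (case_pvar x y) \<Phi>"

text \<open>Definition by recursion in \<open>M\<close>: \<open>F : M \<times> Sent \<rightarrow> Sent\<close> is a definable function of \<open>M\<close>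
  satisfying the recursion equations. Definability (variables 0, 1, 2 standing for the arguments
  and the value, the remaining ones for parameters) is what determines \<open>F\<close> at nonstandard
  arguments, see \<open>operator_unique\<close> below.\<close>

definition definable_op :: "'a arith \<Rightarrow> ('a \<Rightarrow> 'a \<Rightarrow> 'a) \<Rightarrow> bool" where
  "definable_op M F \<longleftrightarrow>
     (\<exists>A e. \<forall>x \<phi> y. is_sent M \<phi> \<longrightarrow> (sat M (e(0 := x, 1 := \<phi>, 2 := y)) A \<longleftrightarrow> F x \<phi> = y))"

definition idempotent_operator :: "'a arith \<Rightarrow> pvar template \<Rightarrow> ('a \<Rightarrow> 'a \<Rightarrow> 'a) \<Rightarrow> bool" where
  "idempotent_operator M \<Phi> F \<longleftrightarrow>
     idempotent_template \<Phi> \<and>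
     definable_op M F \<and>
     (\<forall>x \<phi>. is_sent M \<phi> \<longrightarrow> is_sent M (F x \<phi>)) \<and>
     (\<forall>\<phi>. is_sent M \<phi> \<longrightarrow> F \<zero>\<^bsub>M\<^esub> \<phi> = \<phi>) \<and>
     (\<forall>x \<phi>. is_sent M \<phi> \<longrightarrow> F (suc M x) \<phi> = tinst_pq M \<Phi> \<phi> (F x \<phi>))"

definition additive :: "pvar template \<Rightarrow> bool" where
  "additive \<Phi> \<longleftrightarrow> P \<notin> atoms \<Phi>"

primrec ren_tm :: "(nat \<Rightarrow> nat) \<Rightarrow> tm \<Rightarrow> tm" where
  "ren_tm f (Var i) = Var (f i)"
| "ren_tm f Zero = Zero"
| "ren_tm f (Succ t) = Succ (ren_tm f t)"
| "ren_tm f (Add s t) = Add (ren_tm f s) (ren_tm f t)"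
| "ren_tm f (Mul s t) = Mul (ren_tm f s) (ren_tm f t)"

primrec ren :: "(nat \<Rightarrow> nat) \<Rightarrow> fm \<Rightarrow> fm" where
  "ren f (Eq s t) = Eq (ren_tm f s) (ren_tm f t)"
| "ren f (Or A B) = Or (ren f A) (ren f B)"
| "ren f (Neg A) = Neg (ren f A)"
| "ren f (Ex i A) = Ex (f i) (ren f A)"

lemma tm_val_ren: "tm_val M e (ren_tm f t) = tm_val M (\<lambda>i. e (f i)) t"
  by (induction t) auto

lemma sat_ren: "inj f \<Longrightarrow> sat M e (ren f A) \<longleftrightarrow> sat M (\<lambda>i. e (f i)) A"
proof (induction A arbitrary: e)
  case (Ex i A)
  have "(\<lambda>j. (e(f i := x)) (f j)) = (\<lambda>j. e (f j))(i := x)" for x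
    using Ex.prems by (auto simp: fun_eq_iff inj_eq)
  then show ?case using Ex by simp
qed (auto simp: tm_val_ren)

lemma PA_induct:
  assumes "PA_model M" "sat M (e(i := \<zero>\<^bsub>M\<^esub>)) A"
    and "\<And>x. sat M (e(i := x)) A \<Longrightarrow> sat M (e(i := suc M x)) A"
  shows "sat M (e(i := x)) A"
  using assms unfolding PA_model_def by blast

lemma operator_unique:
  assumes PA: "PA_model M" and F: "idempotent_operator M \<Phi> F" and G: "idempotent_operator M \<Phi> G"
    and \<phi>: "is_sent M \<phi>"
  shows "F x \<phi> = G x \<phi>"
proof -
  have "definable_op M F" "definable_op M G" using F G by (simp_all add: idempotent_operator_def)
  then obtain A d B d' where
    "\<forall>x \<phi> y. is_sent M \<phi> \<longrightarrow> (sat M (d(0 := x, 1 := \<phi>, 2 := y)) A \<longleftrightarrow> F x \<phi> = y)"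
    "\<forall>x \<phi> y. is_sent M \<phi> \<longrightarrow> (sat M (d'(0 := x, 1 := \<phi>, 2 := y)) B \<longleftrightarrow> G x \<phi> = y)"
    unfolding definable_op_def by (elim exE)
  note A = this(1)[rule_format, OF \<phi>] and B = this(2)[rule_format, OF \<phi>]
  define e where "e = (\<lambda>i::nat. if even i then (d(1 := \<phi>)) (i div 2) else (d'(1 := \<phi>)) (i div 2))"
  define C where "C = Ex 4 (Ex 1 (Ex 5 (Neg (Or (Or (Neg (Eq (Var 1) (Var 0))) (Neg (Eq (Var 5) (Var 4))))
     (Or (Neg (ren (\<lambda>i. 2 * i) A)) (Neg (ren (\<lambda>i. 2 * i + 1) B)))))))"
  have inj: "inj (\<lambda>i::nat. 2 * i)" "inj (\<lambda>i::nat. 2 * i + 1)" by (auto simp: inj_def)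
  have e1: "(\<lambda>i. (e(0 := x, 4 := y, 1 := x, 5 := y)) (2 * i)) = d(0 := x, 1 := \<phi>, 2 := y)" for x y
  proof
    fix i :: nat
    have "2 * i \<noteq> 1" "2 * i \<noteq> 5" by presburger+
    then show "(e(0 := x, 4 := y, 1 := x, 5 := y)) (2 * i) = (d(0 := x, 1 := \<phi>, 2 := y)) i"
      by (simp add: e_def)
  qed
  have e2: "(\<lambda>i. (e(0 := x, 4 := y, 1 := x, 5 := y)) (2 * i + 1)) = d'(0 := x, 1 := \<phi>, 2 := y)" for x y
  proof
    fix i :: nat
    have "2 * i + 1 \<noteq> 4" by presburger
    then show "(e(0 := x, 4 := y, 1 := x, 5 := y)) (2 * i + 1) = (d'(0 := x, 1 := \<phi>, 2 := y)) i"
      by (cases "i = 0"; cases "i = 2") (auto simp: e_def)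
  qed
  let ?e = "\<lambda>x y. e(0 := x, 4 := y, 1 := x, 5 := y)"
  have "sat M (?e x y) (ren (\<lambda>i. 2 * i) A) \<longleftrightarrow> F x \<phi> = y" for x y
    by (subst sat_ren[OF inj(1)], subst e1, rule A)
  moreover have "sat M (?e x y) (ren (\<lambda>i. 2 * i + 1) B) \<longleftrightarrow> G x \<phi> = y" for x y
    by (subst sat_ren[OF inj(2)], subst e2, rule B)
  moreover have "sat M (e(0 := x)) C \<longleftrightarrow>
      (\<exists>y. sat M (?e x y) (ren (\<lambda>i. 2 * i) A) \<and> sat M (?e x y) (ren (\<lambda>i. 2 * i + 1) B))" for x
    by (simp add: C_def)
  ultimately have C: "sat M (e(0 := x)) C \<longleftrightarrow> F x \<phi> = G x \<phi>" for x
    by (simp only:) (auto simp only:)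
  have "sat M (e(0 := x)) C"
  proof (rule PA_induct[OF PA])
    show "sat M (e(0 := \<zero>\<^bsub>M\<^esub>)) C"
      unfolding C using F G \<phi> by (simp add: idempotent_operator_def)
    show "sat M (e(0 := suc M x)) C" if "sat M (e(0 := x)) C" for x
      using that F G \<phi> unfolding C by (simp add: idempotent_operator_def)
  qed
  then show ?thesis unfolding C .
qed

end

theory Submission
  imports Defs
begin

text \<open>For an additive template, \<open>F (x + 1) \<phi>\<close> depends on \<open>F x \<phi>\<close> alone, so induction on \<open>x\<close> inside
  \<open>M\<close> gives \<open>F (y + x) \<phi> = F x (F y \<phi>)\<close>. An element \<open>x \<le> c + d\<close> is either below \<open>c\<close> or of the form
  \<open>c + z\<close> with \<open>z \<le> d\<close>; in the second case \<open>\<phi>\<close>, \<open>F c \<phi>\<close> and \<open>F z (F c \<phi>)\<close> have the same truth value,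
  as \<open>F c \<phi>\<close> is again a sentence.\<close>

locale PA =
  fixes M :: "'a arith"
  assumes model: "PA_model M"
begin

lemma add_zero [simp]: "x \<oplus>\<^bsub>M\<^esub> \<zero>\<^bsub>M\<^esub> = x"
  and add_suc [simp]: "x \<oplus>\<^bsub>M\<^esub> suc M y = suc M (x \<oplus>\<^bsub>M\<^esub> y)"
  and suc_inject [simp]: "suc M x = suc M y \<longleftrightarrow> x = y"
  using model by (auto simp: PA_model_def)

text \<open>Induction in \<open>M\<close> is available only for properties defined by an
  arithmetical formula with parameters. The first premise asks for that definition: formula
  \<open>A\<close>, parameters \<open>e\<close>, induction variable \<open>i\<close>.\<close>

lemma induct_formula:
  assumes "\<And>x. sat M (e(i := x)) A \<longleftrightarrow> Pr x"
    and "Pr \<zero>\<^bsub>M\<^esub>" "\<And>x. Pr x \<Longrightarrow> Pr (suc M x)"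
  shows "Pr x"
  using PA_induct[OF model, of e i A x] assms by simp

lemma zero_or_suc: "x = \<zero>\<^bsub>M\<^esub> \<or> (\<exists>y. x = suc M y)"
  by (rule induct_formula[where e = "\<lambda>_. x" and i = 0 and
        A = "Or (Eq (Var 0) Zero) (Ex 1 (Eq (Var 0) (Succ (Var 1))))"]) auto

lemma add_assoc: "x \<oplus>\<^bsub>M\<^esub> y \<oplus>\<^bsub>M\<^esub> z = x \<oplus>\<^bsub>M\<^esub> (y \<oplus>\<^bsub>M\<^esub> z)"
  by (rule induct_formula[where x = z and e = "(\<lambda>_. x)(1 := y)" and i = 2 and
        A = "Eq (Add (Add (Var 0) (Var 1)) (Var 2)) (Add (Var 0) (Add (Var 1) (Var 2)))"]) auto

lemma zero_add [simp]: "\<zero>\<^bsub>M\<^esub> \<oplus>\<^bsub>M\<^esub> x = x"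
  by (rule induct_formula[where e = "\<lambda>_. x" and i = 0 and
        A = "Eq (Add Zero (Var 0)) (Var 0)"]) auto

lemma suc_add [simp]: "suc M x \<oplus>\<^bsub>M\<^esub> y = suc M (x \<oplus>\<^bsub>M\<^esub> y)"
  by (rule induct_formula[where x = y and e = "\<lambda>_. x" and i = 1 and
        A = "Eq (Add (Succ (Var 0)) (Var 1)) (Succ (Add (Var 0) (Var 1)))"]) auto

text \<open>Kept as an object-level implication because the whole implication is the induction
  formula, with \<open>x\<close> as induction variable and \<open>y\<close>, \<open>z\<close> as
  parameters.\<close>

lemma add_left_cancel: "x \<oplus>\<^bsub>M\<^esub> y = x \<oplus>\<^bsub>M\<^esub> z \<longrightarrow> y = z"
  by (rule induct_formula[where x = x and e = "(\<lambda>_. y)(1 := z)" and i = 2 and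
        A = "Or (Neg (Eq (Add (Var 2) (Var 0)) (Add (Var 2) (Var 1)))) (Eq (Var 0) (Var 1))"]) auto

lemma le_linear: "le M x y \<or> le M y x"
proof (rule induct_formula[where x = x and e = "\<lambda>_. y" and i = 1 and
        A = "Or (Ex 2 (Eq (Add (Var 1) (Var 2)) (Var 0))) (Ex 2 (Eq (Add (Var 0) (Var 2)) (Var 1)))"])
  show "le M \<zero>\<^bsub>M\<^esub> y \<or> le M y \<zero>\<^bsub>M\<^esub>" by (simp add: le_def)
next
  fix x assume "le M x y \<or> le M y x"
  then show "le M (suc M x) y \<or> le M y (suc M x)"
  proof
    assume "le M x y"
    then obtain z where z: "x \<oplus>\<^bsub>M\<^esub> z = y" by (auto simp: le_def)
    \<comment> \<open>The gap \<open>z\<close> decides the side: a zero gap means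
      \<open>suc M x\<close> has just passed \<open>y\<close>, a successor gap leaves room below
      \<open>y\<close>.\<close>
    from zero_or_suc[of z] show ?thesis
    proof
      assume "z = \<zero>\<^bsub>M\<^esub>"
      with z have "y \<oplus>\<^bsub>M\<^esub> suc M \<zero>\<^bsub>M\<^esub> = suc M x" by simp
      then show ?thesis unfolding le_def by blast
    next
      assume "\<exists>w. z = suc M w"
      with z show ?thesis by (auto simp: le_def)
    qed
  next
    assume "le M y x"
    then show ?thesis unfolding le_def by (metis add_suc)
  qed
qed (auto simp: le_def)

text \<open>By linearity, failure of the first case gives \<open>x\<close> the form
  \<open>c + z\<close>; cancelling \<open>c\<close> then bounds \<open>z\<close> by
  \<open>d\<close>.\<close>

lemma le_add_cases:
  assumes "le M x (c \<oplus>\<^bsub>M\<^esub> d)"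
  obtains "le M x c" | z where "le M z d" "x = c \<oplus>\<^bsub>M\<^esub> z"
proof (cases "le M x c")
  case False
  then obtain z where z: "x = c \<oplus>\<^bsub>M\<^esub> z" using le_linear[of x c] by (auto simp: le_def)
  moreover obtain w where "x \<oplus>\<^bsub>M\<^esub> w = c \<oplus>\<^bsub>M\<^esub> d" using assms by (auto simp: le_def)
  ultimately have "z \<oplus>\<^bsub>M\<^esub> w = d" by (simp add: add_assoc add_left_cancel[rule_format])
  with z that(2) show ?thesis by (auto simp: le_def)
qed (rule that(1))

end

lemma tinst_cong: "(\<And>v. v \<in> atoms A \<Longrightarrow> f v = g v) \<Longrightarrow> tinst M f A = tinst M g A"
  by (induction A) auto

lemma tinst_pq_additive: "additive \<Phi> \<Longrightarrow> tinst_pq M \<Phi> x z = tinst_pq M \<Phi> y z"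
  by (rule tinst_cong) (auto simp: additive_def split: pvar.split)

lemma additive_operator_add:
  assumes PA: "PA_model M" and F: "idempotent_operator M \<Phi> F" and "additive \<Phi>"
    and \<phi>: "is_sent M \<phi>"
  shows "F (y \<oplus>\<^bsub>M\<^esub> x) \<phi> = F x (F y \<phi>)"
proof -
  interpret PA M by unfold_locales (rule PA)
  define \<psi> where "\<psi> = F y \<phi>"
  have \<psi>: "is_sent M \<psi>" using F \<phi> by (simp add: \<psi>_def idempotent_operator_def)
  \<comment> \<open>Additivity enters here: the place of p can be filled with the fixed
    \<open>\<phi>\<close> whatever \<open>\<chi>\<close> is, so iterations from
    \<open>\<phi>\<close> and from \<open>\<psi>\<close> take the same successor step.\<close>
  have F_suc: "F (suc M x) \<chi> = tinst_pq M \<Phi> \<phi> (F x \<chi>)" if "is_sent M \<chi>" for x \<chi>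
    using F that tinst_pq_additive[OF \<open>additive \<Phi>\<close>, of M] by (auto simp: idempotent_operator_def)
  obtain A d where A:
    "\<And>x \<chi> z. is_sent M \<chi> \<Longrightarrow> sat M (d(0 := x, 1 := \<chi>, 2 := z)) A \<longleftrightarrow> F x \<chi> = z"
    using F unfolding idempotent_operator_def definable_op_def by blast
  \<comment> \<open>Variables \<open>3 i\<close> and \<open>3 i + 1\<close> belong to two copies of \<open>A\<close>, and variable 2 holds \<open>y\<close>.\<close>
  define e where "e = (\<lambda>i::nat. if i = 2 then y
    else if i mod 3 = 0 then (d(1 := \<phi>)) (i div 3) else (d(1 := \<psi>)) (i div 3))"
  define A1 where "A1 = ren (\<lambda>i. 3 * i) A"
  define A2 where "A2 = ren (\<lambda>i. 3 * i + 1) A"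
  \<comment> \<open>Variables 0 and 6 are argument and value of \<open>F\<close> in the first copy,
    1 and 7 in the second. \<open>C\<close> says that the values at \<open>y + x\<close> (from
    \<open>\<phi>\<close>) and at \<open>x\<close> (from \<open>\<psi>\<close>) agree.\<close>
  define C where "C = Ex 0 (Ex 6 (Ex 7 (Neg (Or
     (Or (Neg (Eq (Var 0) (Add (Var 2) (Var 1)))) (Neg (Eq (Var 7) (Var 6)))) (Or (Neg A1) (Neg A2))))))"
  let ?e = "\<lambda>x u z. e(1 := x, 0 := u, 6 := z, 7 := z)"
  have inj: "inj (\<lambda>i::nat. 3 * i)" "inj (\<lambda>i::nat. 3 * i + 1)" by (auto simp: inj_def)
  have "(\<lambda>i. ?e x u z (3 * i)) = d(0 := u, 1 := \<phi>, 2 := z)" for x u z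
  proof
    fix i :: nat
    have "3 * i \<noteq> 1" "3 * i \<noteq> 2" "3 * i \<noteq> 7" by presburger+
    then show "?e x u z (3 * i) = (d(0 := u, 1 := \<phi>, 2 := z)) i" by (simp add: e_def)
  qed
  then have A1: "sat M (?e x u z) A1 \<longleftrightarrow> F u \<phi> = z" for x u z
    unfolding A1_def by (subst sat_ren[OF inj(1)]) (simp only: A[OF \<phi>])
  have "(\<lambda>i. ?e x u z (3 * i + 1)) = d(0 := x, 1 := \<psi>, 2 := z)" for x u z
  proof
    fix i :: nat
    have "3 * i + 1 \<noteq> 2" "3 * i + 1 \<noteq> 6" "(3 * i + 1) mod 3 = 1" "(3 * i + 1) div 3 = i"
      by presburger+
    then show "?e x u z (3 * i + 1) = (d(0 := x, 1 := \<psi>, 2 := z)) i"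
      by (cases "i = 0"; cases "i = 2") (auto simp: e_def)
  qed
  then have A2: "sat M (?e x u z) A2 \<longleftrightarrow> F x \<psi> = z" for x u z
    unfolding A2_def by (subst sat_ren[OF inj(2)]) (simp only: A[OF \<psi>])
  have "sat M (e(1 := x)) C \<longleftrightarrow>
      (\<exists>z. sat M (?e x (y \<oplus>\<^bsub>M\<^esub> x) z) A1 \<and> sat M (?e x (y \<oplus>\<^bsub>M\<^esub> x) z) A2)" for x
    by (simp add: C_def) (simp add: e_def)
  \<comment> \<open>As \<open>F\<close> is a function, having a common value \<open>z\<close> is the
    same as equality.\<close>
  then have C: "sat M (e(1 := x)) C \<longleftrightarrow> F (y \<oplus>\<^bsub>M\<^esub> x) \<phi> = F x \<psi>" for x
    by (simp only: A1 A2) (auto simp only:)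
  have "F (y \<oplus>\<^bsub>M\<^esub> x) \<phi> = F x \<psi>"
  proof (rule induct_formula[OF C])
    show "F (y \<oplus>\<^bsub>M\<^esub> \<zero>\<^bsub>M\<^esub>) \<phi> = F \<zero>\<^bsub>M\<^esub> \<psi>"
      using F \<psi> by (simp add: idempotent_operator_def \<psi>_def)
    show "F (y \<oplus>\<^bsub>M\<^esub> suc M x) \<phi> = F (suc M x) \<psi>" if "F (y \<oplus>\<^bsub>M\<^esub> x) \<phi> = F x \<psi>" for x
      using that by (simp add: F_suc \<phi> \<psi>)
  qed
  then show ?thesis by (simp add: \<psi>_def)
qed

theorem theorem4p7:
  fixes M :: "'a arith" and S :: "('a \<times> 'a) set"
    and \<Phi> :: "pvar template" and F :: "'a \<Rightarrow> 'a \<Rightarrow> 'a" and I :: "'a set"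
  assumes "CS_minus M S"
    and "idempotent_operator M \<Phi> F"
    and "additive \<Phi>"
    and "I = {c. \<forall>x. le M x c \<longrightarrow> (\<forall>\<phi>. is_sent M \<phi> \<longrightarrow> (truth M S \<phi> \<longleftrightarrow> truth M S (F x \<phi>)))}"
  shows "\<forall>c\<in>I. \<forall>d\<in>I. c \<oplus>\<^bsub>M\<^esub> d \<in> I"
proof (intro ballI)
  fix c d assume "c \<in> I" "d \<in> I"
  then have c: "\<And>x \<phi>. le M x c \<Longrightarrow> is_sent M \<phi> \<Longrightarrow> truth M S \<phi> \<longleftrightarrow> truth M S (F x \<phi>)"
    and d: "\<And>x \<phi>. le M x d \<Longrightarrow> is_sent M \<phi> \<Longrightarrow> truth M S \<phi> \<longleftrightarrow> truth M S (F x \<phi>)"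
    unfolding assms(4) by blast+
  have PA: "PA_model M" using assms(1) by (simp add: CS_minus_def)
  interpret PA M by unfold_locales (rule PA)
  have "truth M S \<phi> \<longleftrightarrow> truth M S (F x \<phi>)" if x: "le M x (c \<oplus>\<^bsub>M\<^esub> d)" and \<phi>: "is_sent M \<phi>" for x \<phi>
    using x
  proof (cases rule: le_add_cases)
    case 1
    then show ?thesis using c \<phi> by blast
  next
    case (2 z)
    \<comment> \<open>Membership of \<open>c\<close> in \<open>I\<close> is needed at
      \<open>c\<close> itself.\<close>
    have "le M c c" unfolding le_def by (metis add_zero)
    then have "truth M S \<phi> \<longleftrightarrow> truth M S (F c \<phi>)" using c \<phi> by blast
    also have "\<dots> \<longleftrightarrow> truth M S (F z (F c \<phi>))"
      using d[OF 2(1)] assms(2) \<phi> by (simp add: idempotent_operator_def)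
    \<comment> \<open>The addition law at \<open>c\<close> and \<open>z\<close> identifies
      \<open>F z (F c \<phi>)\<close> with \<open>F x \<phi>\<close>.\<close>
    finally show ?thesis
      using additive_operator_add[OF PA assms(2,3) \<phi>] 2(2) by simp
  qed
  then show "c \<oplus>\<^bsub>M\<^esub> d \<in> I" using assms(4) by blast
qed

end
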